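(* Let $s\ge0$ be an integer, $h\in\mathbb C\setminus\{0\}$ and $q\in\mathbb C\setminus\{0\}$. For all nonnegative integers $n,m$, as polynomials in $x$, $$B_{s,h,q}[n+m;x]=\sum_{r=0}^n\sum_{j=0}^mh^{n-r}q^{r(j(1-s)+sm)}\genfrac{[}{]}{0pt}{}{n}{r}_{q^s}S_{s,h,q}[m,j]\,B_{s,h,q}[r;x]\,x^j\prod_{i=0}^{n-r-1}[j(1-s)+sm+si]_q .$$ In particular, for $n\ge1$, $$B_{s,h,q}[n;x]=\sum_{r=0}^{n-1}h^{n-r-1}q^r\genfrac{[}{]}{0pt}{}{n-1}{r}_{q^s}B_{s,h,q}[r;x]\,x\prod_{i=0}^{n-r-2}[1+si]_q .$$ Moreover, writing $S_q[n,k]=S_{0,1,q}[n,k]$ and $B_q[n]=B_{0,1,q}[n;1]$, for all nonnegative integers $n,m$, $$B_q[n+m]=\sum_{r=0}^n\sum_{j=0}^mq^{rj}\binom nrS_q[m,j]\,B_q[r]\,[j]_q^{n-r},$$ where $0^0=1$.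
   Context: For an integer $x$, $[x]_q=\frac{q^x-1}{q-1}$ if $q\ne1$ and $[x]_1=x$. $\genfrac{[}{]}{0pt}{}{n}{k}_p$ is the Gaussian ($p$-binomial) coefficient, understood as a polynomial in $p$ evaluated at the given value. The numbers $S_{s,h,q}[n,k]$ are the coefficients in $(VU)^n=\sum_{k=0}^nS_{s,h,q}[n,k]V^{sn-(s-1)k}U^k$, where $UV-qVU=hV^s$; equivalently they are determined by $S_{s,h,q}[n,k]=q^{s(n-1)-(s-1)(k-1)}S_{s,h,q}[n-1,k-1]+h[s(n-1)-(s-1)k]_q\,S_{s,h,q}[n-1,k]$ for $n,k\ge1$, with $S_{s,h,q}[n,0]=S_{s,h,q}[0,n]=\delta_{0,n}$. The generalized $q$-Bell polynomials are $B_{s,h,q}[n;x]=\sum_{k=0}^nS_{s,h,q}[n,k]x^k$. Empty products equal $1$. *)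

theory Defs
  imports Complex_Main "HOL-Computational_Algebra.Polynomial"
begin

definition q_bracket :: "complex \<Rightarrow> int \<Rightarrow> complex" where
  "q_bracket q x = (if q = 1 then of_int x else (q powi x - 1) / (q - 1))"

text \<open>
  The Gaussian coefficient is a polynomial in \<open>p\<close>, so that evaluating it also makes sense at
  roots of unity, where the quotient of the evaluated factorials would be \<open>0 / 0\<close>.
  The polynomial division is exact, see \<open>gauss_poly_mult_fact\<close> below.
\<close>

definition bracket_poly :: "nat \<Rightarrow> complex poly" where
  "bracket_poly n = (\<Sum>i<n. monom 1 i)"

definition fact_poly :: "nat \<Rightarrow> complex poly" where
  "fact_poly n = (\<Prod>i=1..n. bracket_poly i)"

definition gauss_poly :: "nat \<Rightarrow> nat \<Rightarrow> complex poly" where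
  "gauss_poly n k = (if k \<le> n then fact_poly n div (fact_poly k * fact_poly (n - k)) else 0)"

definition gauss_binomial :: "complex \<Rightarrow> nat \<Rightarrow> nat \<Rightarrow> complex" where
  "gauss_binomial p n k = poly (gauss_poly n k) p"

text \<open>
  The numbers \<open>S\<^bsub>s,h,q\<^esub>[n, k]\<close>, by their recurrence. That they are the normal ordering
  coefficients of \<open>(V U)\<^sup>n\<close> when \<open>U V - q V U = h V\<^sup>s\<close> is \<open>gen_stirling_normal_ordering\<close> below.
  The exponents are integers: they may be negative where \<open>k > n\<close>, and there the values are \<open>0\<close>.
\<close>

fun gen_stirling :: "nat \<Rightarrow> complex \<Rightarrow> complex \<Rightarrow> nat \<Rightarrow> nat \<Rightarrow> complex" where
  "gen_stirling s h q 0 0 = 1"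
| "gen_stirling s h q (Suc n) 0 = 0"
| "gen_stirling s h q 0 (Suc k) = 0"
| "gen_stirling s h q (Suc n) (Suc k) =
     q powi (int s * int n - (int s - 1) * int k) * gen_stirling s h q n k
     + h * q_bracket q (int s * int n - (int s - 1) * int (Suc k)) * gen_stirling s h q n (Suc k)"

definition gen_bell :: "nat \<Rightarrow> complex \<Rightarrow> complex \<Rightarrow> nat \<Rightarrow> complex poly" where
  "gen_bell s h q n = (\<Sum>k\<le>n. monom (gen_stirling s h q n k) k)"

definition q_stirling :: "complex \<Rightarrow> nat \<Rightarrow> nat \<Rightarrow> complex" where
  "q_stirling q n k = gen_stirling 0 1 q n k"

definition q_bell :: "complex \<Rightarrow> nat \<Rightarrow> complex" where
  "q_bell q n = poly (gen_bell 0 1 q n) 1"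


lemma bracket_poly_nz: "n \<ge> 1 \<Longrightarrow> bracket_poly n \<noteq> 0"
proof -
  assume "n \<ge> 1"
  have "coeff (bracket_poly n) 0 = (\<Sum>i<n. if i = 0 then 1 else 0)"
    unfolding bracket_poly_def coeff_sum by (rule sum.cong) auto
  also have "\<dots> = 1" using \<open>n \<ge> 1\<close> by (subst sum.delta) auto
  finally show ?thesis by auto
qed

lemma fact_poly_nz: "fact_poly n \<noteq> 0"
  using bracket_poly_nz by (auto simp: fact_poly_def)

lemma fact_poly_0: "fact_poly 0 = 1"
  by (simp add: fact_poly_def)

lemma fact_poly_Suc: "fact_poly (Suc n) = fact_poly n * bracket_poly (Suc n)"
  by (simp add: fact_poly_def)

lemma bracket_poly_add: "bracket_poly (a + b) = bracket_poly a + monom 1 a * bracket_poly b"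
  by (induction b) (simp_all add: bracket_poly_def mult_monom algebra_simps)

lemma fact_poly_dvd: "fact_poly a * fact_poly b dvd fact_poly (a + b)"
proof (induction "a + b" arbitrary: a b)
  case 0
  then show ?case by (simp add: fact_poly_0)
next
  case (Suc n)
  show ?case
  proof (cases "a = 0 \<or> b = 0")
    case True
    then show ?thesis by (auto simp: fact_poly_0)
  next
    case False
    then obtain c d where ab: "a = Suc c" "b = Suc d"
      by (meson not0_implies_Suc)
    with Suc(2) have n: "n = c + b" "n = a + d" by auto
    have 1: "fact_poly a * fact_poly b dvd fact_poly n * bracket_poly a"
      using mult_dvd_mono[OF Suc(1)[OF n(1)] dvd_refl[of "bracket_poly a"]] n(1)
      by (simp add: ab fact_poly_Suc mult_ac)
    have 2: "fact_poly a * fact_poly b dvd fact_poly n * bracket_poly b"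
      using mult_dvd_mono[OF Suc(1)[OF n(2)] dvd_refl[of "bracket_poly b"]] n(2)
      by (simp add: ab fact_poly_Suc mult_ac)
    have "fact_poly (a + b) = fact_poly n * bracket_poly (a + b)"
      using Suc(2) fact_poly_Suc[of n] by simp
    also have "\<dots> = fact_poly n * bracket_poly a + monom 1 a * (fact_poly n * bracket_poly b)"
      by (simp add: bracket_poly_add algebra_simps)
    finally show ?thesis using 1 2 by (simp add: dvd_add dvd_mult)
  qed
qed

lemma gauss_poly_mult_fact:
  "k \<le> n \<Longrightarrow> gauss_poly n k * (fact_poly k * fact_poly (n - k)) = fact_poly n"
  using fact_poly_dvd[of k "n - k"] by (simp add: gauss_poly_def)


lemma q_bracket_Suc:
  assumes "q \<noteq> 0"
  shows "q_bracket q (int (Suc e)) = q ^ e + q_bracket q (int e)"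
proof (cases "q = 1")
  case False
  then show ?thesis unfolding q_bracket_def power_int_of_nat by (simp add: field_simps)
qed (simp add: q_bracket_def)

lemma gen_stirling_0: "n < k \<Longrightarrow> gen_stirling s h q n k = 0"
proof (induction n arbitrary: k)
  case 0
  then show ?case by (cases k) auto
next
  case (Suc n)
  then show ?case by (cases k) auto
qed

lemma normal_ordering_step:
  fixes U V :: "'a :: ring_1" and \<iota> :: "complex \<Rightarrow> 'a"
  assumes q: "q \<noteq> 0"
    and add: "\<And>a b. \<iota> (a + b) = \<iota> a + \<iota> b" and mult: "\<And>a b. \<iota> (a * b) = \<iota> a * \<iota> b"
    and one: "\<iota> 1 = 1" and central: "\<And>a x. \<iota> a * x = x * \<iota> a"
    and UV: "U * V - \<iota> q * (V * U) = \<iota> h * V ^ s"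
  shows "V * U * V ^ e = \<iota> (q ^ e) * (V ^ Suc e * U) + \<iota> (h * q_bracket q (int e)) * V ^ (e + s)"
proof (induction e)
  case 0
  have "\<iota> 0 = 0" using add[of 0 0] by simp
  then show ?case by (simp add: q_bracket_def one)
next
  case (Suc e)
  have UV': "U * V = \<iota> q * (V * U) + \<iota> h * V ^ s"
    using UV by (simp add: diff_eq_eq add.commute)
  have 1: "\<iota> (q ^ e) * (V ^ Suc e * U) * V
      = \<iota> (q ^ e * q) * (V ^ Suc (Suc e) * U) + \<iota> (q ^ e * h) * V ^ (Suc e + s)"
  proof -
    have "V ^ Suc e * (\<iota> q * (V * U)) = \<iota> q * (V ^ Suc (Suc e) * U)"
      by (simp only: central[of q] mult.assoc power_Suc2)
    moreover have "V ^ Suc e * (\<iota> h * V ^ s) = \<iota> h * V ^ (Suc e + s)"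
      by (simp only: central[of h] mult.assoc power_add)
    ultimately have "V ^ Suc e * (U * V) = \<iota> q * (V ^ Suc (Suc e) * U) + \<iota> h * V ^ (Suc e + s)"
      by (simp only: UV' distrib_left)
    then show ?thesis by (simp only: mult mult.assoc distrib_left)
  qed
  have 2: "\<iota> (h * q_bracket q (int e)) * V ^ (e + s) * V
      = \<iota> (h * q_bracket q (int e)) * V ^ (Suc e + s)"
    by (simp only: mult.assoc power_Suc2[symmetric] add_Suc)
  have 3: "h * q_bracket q (int (Suc e)) = q ^ e * h + h * q_bracket q (int e)"
    by (simp only: q_bracket_Suc[OF q] distrib_left mult.commute)
  have "V * U * V ^ Suc e = (V * U * V ^ e) * V"
    by (simp only: power_Suc2 mult.assoc)
  also have "\<dots> = \<iota> (q ^ e) * (V ^ Suc e * U) * V + \<iota> (h * q_bracket q (int e)) * V ^ (e + s) * V"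
    by (simp only: Suc.IH distrib_right)
  also have "\<dots> = \<iota> (q ^ Suc e) * (V ^ Suc (Suc e) * U)
      + \<iota> (h * q_bracket q (int (Suc e))) * V ^ (Suc e + s)"
    by (simp only: 1 2 3 add distrib_right add.assoc power_Suc2[of q])
  finally show ?case .
qed

text \<open>
  \<open>\<iota>\<close> embeds the scalars into a complex algebra with unit. For \<open>k \<le> n\<close> the exponent of \<open>V\<close> is
  \<open>s n - (s - 1) k = s (n - k) + k\<close>.
\<close>

theorem gen_stirling_normal_ordering:
  fixes U V :: "'a :: ring_1" and \<iota> :: "complex \<Rightarrow> 'a"
  assumes q: "q \<noteq> 0"
    and add: "\<And>a b. \<iota> (a + b) = \<iota> a + \<iota> b" and mult: "\<And>a b. \<iota> (a * b) = \<iota> a * \<iota> b"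
    and one: "\<iota> 1 = 1" and central: "\<And>a x. \<iota> a * x = x * \<iota> a"
    and UV: "U * V - \<iota> q * (V * U) = \<iota> h * V ^ s"
  shows "(V * U) ^ n = (\<Sum>k\<le>n. \<iota> (gen_stirling s h q n k) * (V ^ (s * (n - k) + k) * U ^ k))"
proof (induction n)
  case 0
  then show ?case by (simp add: one)
next
  case (Suc n)
  have zero: "\<iota> 0 = 0" using add[of 0 0] by simp
  define S where "S = gen_stirling s h q n"
  define e where "e k = s * (n - k) + k" for k
  have e_int: "int (e k) = int s * int n - (int s - 1) * int k" if k: "k \<le> n" for k
  proof -
    obtain d where "n = k + d" using k le_Suc_ex by blast
    then show ?thesis by (simp add: e_def algebra_simps)
  qed
  define f where "f k = \<iota> (S k * q ^ e k) * (V ^ Suc (e k) * U ^ Suc k)" for k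
  define g where "g k = \<iota> (h * q_bracket q (int (e k)) * S k) * (V ^ (e k + s) * U ^ k)" for k
  have term_eq: "V * U * (\<iota> (S k) * (V ^ e k * U ^ k)) = f k + g k" for k
  proof -
    have "V * U * (\<iota> (S k) * (V ^ e k * U ^ k)) = \<iota> (S k) * ((V * U * V ^ e k) * U ^ k)"
      by (metis central mult.assoc)
    also have "\<dots> = f k + g k"
      unfolding normal_ordering_step[OF q add mult one central UV] f_def g_def
      by (simp add: mult distrib_left distrib_right mult.assoc)
         (metis central mult.assoc)
    finally show ?thesis .
  qed
  have "(V * U) ^ Suc n = (\<Sum>k\<le>n. f k + g k)"
    unfolding power_Suc Suc sum_distrib_left S_def[symmetric] e_def[symmetric] term_eq ..
  also have "\<dots> = (\<Sum>k\<le>n. f k) + (\<Sum>k\<le>n. g k)" by (rule sum.distrib)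
  also have "(\<Sum>k\<le>n. g k) = g 0 + (\<Sum>k\<le>n. g (Suc k))"
  proof -
    have "g (Suc n) = 0" by (simp add: g_def S_def gen_stirling_0 zero)
    then show ?thesis using sum.atMost_Suc[of g n] sum.atMost_Suc_shift[of g n] by simp
  qed
  also have "g 0 = 0"
    by (cases n) (auto simp: g_def S_def e_def q_bracket_def zero)
  also have "(\<Sum>k\<le>n. f k) + (0 + (\<Sum>k\<le>n. g (Suc k))) = (\<Sum>k\<le>n. f k + g (Suc k))"
    by (simp add: sum.distrib)
  also have "\<dots> = (\<Sum>k\<le>n. \<iota> (gen_stirling s h q (Suc n) (Suc k))
                     * (V ^ (s * (Suc n - Suc k) + Suc k) * U ^ Suc k))"
  proof (rule sum.cong[OF refl])
    fix k assume "k \<in> {..n}"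
    then have k: "k \<le> n" by simp
    have ek: "int (e k) = int s * int n - (int s - 1) * int k"
      using k by (rule e_int)
    have 1: "S k * q ^ e k = q powi (int s * int n - (int s - 1) * int k) * S k"
      unfolding ek[symmetric] by (simp add: mult.commute)
    show "f k + g (Suc k) = \<iota> (gen_stirling s h q (Suc n) (Suc k))
                     * (V ^ (s * (Suc n - Suc k) + Suc k) * U ^ Suc k)"
    proof (cases "k = n")
      case True
      then have "g (Suc k) = 0" "gen_stirling s h q n (Suc k) = 0"
        by (simp_all add: g_def S_def gen_stirling_0 zero)
      moreover have "s * (Suc n - Suc k) + Suc k = Suc (e k)" by (simp add: e_def)
      ultimately show ?thesis
        using 1 unfolding f_def gen_stirling.simps S_def by (simp only: mult_zero_right add_0_right)
    next
      case False
      with k have k': "Suc k \<le> n" by simp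
      have "int (e (Suc k)) = int s * int n - (int s - 1) * int (Suc k)"
        using k' by (rule e_int)
      moreover have "e (Suc k) + s = Suc (e k)"
      proof -
        have "n - k = Suc (n - Suc k)" using k' by simp
        then show ?thesis by (simp add: e_def)
      qed
      moreover have "s * (Suc n - Suc k) + Suc k = Suc (e k)" by (simp add: e_def)
      ultimately show ?thesis
        using 1 unfolding f_def g_def gen_stirling.simps add S_def by (simp only: distrib_right)
    qed
  qed
  also have "\<dots> = (\<Sum>k\<le>Suc n. \<iota> (gen_stirling s h q (Suc n) k)
                     * (V ^ (s * (Suc n - k) + k) * U ^ k))"
    unfolding sum.atMost_Suc_shift[of _ n] by (simp only: gen_stirling.simps zero mult_zero_left add_0_left)
  finally show ?case .
qed

end

theory Submission
  imports Defs
begin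

text \<open>
  If \<open>U V = q V U + h V\<^sup>s\<close>, then \<open>(V U) V\<^sup>E = q\<^sup>E V\<^sup>E (V U) + h [E]\<^sub>q V\<^bsup>E+s\<^esup>\<close>, so pushing
  \<open>(V U)\<^sup>n\<close> through \<open>V\<^sup>e\<close> one factor at a time yields
  \<open>\<Sum>\<^sub>r c(n,r) V\<^bsup>e+s(n-r)\<^esup> (V U)\<^sup>r\<close>, where the coefficients \<open>c(n,r)\<close> satisfy a twisted Pascal
  recurrence solved by \<open>q\<^sup>s\<close>-binomials. Applying this to each term of
  \<open>(V U)\<^bsup>n+m\<^esup> = (V U)\<^sup>n \<Sum>\<^sub>j S[m,j] V\<^bsup>sm-(s-1)j\<^esup> U\<^sup>j\<close> gives the theorem.
\<close>

section \<open>Gaussian coefficients: the Pascal rule and the value at 1\<close>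

lemma gauss_poly_0 [simp]: "gauss_poly n 0 = 1"
  using gauss_poly_mult_fact[of 0 n] fact_poly_nz[of n] by (simp add: fact_poly_0)

lemma gauss_poly_eq_0: "n < k \<Longrightarrow> gauss_poly n k = 0"
  by (simp add: gauss_poly_def)

text \<open>Over the common denominator \<open>F\<close> the rule reduces to
  \<open>[n+1] = [n-r] + p^(n-r) [r+1]\<close>. Cancelling \<open>F\<close> among polynomials,
  before evaluation, keeps the rule valid at roots of unity.\<close>

lemma gauss_poly_pascal:
  assumes "r \<le> n"
  shows "gauss_poly (Suc n) (Suc r) = monom 1 (n - r) * gauss_poly n r + gauss_poly n (Suc r)"
proof -
  define F where "F = fact_poly (Suc r) * fact_poly (n - r)"
  have A: "gauss_poly n r * F = fact_poly n * bracket_poly (Suc r)"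
    using gauss_poly_mult_fact[OF assms] by (simp add: F_def fact_poly_Suc mult_ac)
  have B: "gauss_poly n (Suc r) * F = fact_poly n * bracket_poly (n - r)"
  proof (cases "r = n")
    case True
    then show ?thesis by (simp add: gauss_poly_eq_0 bracket_poly_def)
  next
    case False
    with assms have "n - r = Suc (n - Suc r)" "Suc r \<le> n" by auto
    then show ?thesis
      using gauss_poly_mult_fact[of "Suc r" n] by (simp add: F_def fact_poly_Suc mult_ac)
  qed
  have "gauss_poly (Suc n) (Suc r) * F = fact_poly n * bracket_poly (Suc n)"
    using gauss_poly_mult_fact[of "Suc r" "Suc n"] assms by (simp add: F_def fact_poly_Suc)
  also have "bracket_poly (Suc n) = bracket_poly (n - r) + monom 1 (n - r) * bracket_poly (Suc r)"
    using bracket_poly_add[of "n - r" "Suc r"] assms by simp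
  also have "fact_poly n * \<dots> = (monom 1 (n - r) * gauss_poly n r + gauss_poly n (Suc r)) * F"
    by (simp only: distrib_left distrib_right mult.assoc A B mult.left_commute add.commute)
  finally show ?thesis
    using fact_poly_nz by (simp add: F_def)
qed

lemma gauss_binomial_0 [simp]: "gauss_binomial p n 0 = 1"
  by (simp add: gauss_binomial_def)

lemma gauss_binomial_eq_0: "n < k \<Longrightarrow> gauss_binomial p n k = 0"
  by (simp add: gauss_binomial_def gauss_poly_eq_0)

lemma gauss_binomial_pascal:
  "r \<le> n \<Longrightarrow> gauss_binomial p (Suc n) (Suc r)
     = p ^ (n - r) * gauss_binomial p n r + gauss_binomial p n (Suc r)"
  by (simp add: gauss_binomial_def gauss_poly_pascal poly_monom)

text \<open>Serves the case \<open>s = 0\<close>, where the base \<open>q ^ s\<close> is 1.\<close>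

lemma gauss_binomial_1: "gauss_binomial 1 n r = of_nat (n choose r)"
proof (induction n arbitrary: r)
  case 0
  then show ?case by (cases r) (simp_all add: gauss_binomial_eq_0)
next
  case (Suc n)
  then show ?case
    by (cases r; cases "r \<le> Suc n") (simp_all add: gauss_binomial_pascal gauss_binomial_eq_0 binomial_eq_0)
qed

section \<open>Coefficients for moving powers of \<open>V U\<close> past powers of
  \<open>V\<close>\<close>

lemma q_bracket_0 [simp]: "q_bracket q 0 = 0"
  by (simp add: q_bracket_def)

lemma q_bracket_add:
  "q \<noteq> 0 \<Longrightarrow> q_bracket q (a + b) = q_bracket q a + q powi a * q_bracket q b"
  by (simp add: q_bracket_def power_int_add right_diff_distrib add_divide_distrib[symmetric])

text \<open>The coefficient of \<open>V^(e+s(n-r)) (V U)^r\<close> in \<open>(V U)^n V^e\<close>.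
  The exponent \<open>e\<close> is an integer because it is later instantiated with
  \<open>j(1-s)+sm\<close>.\<close>

definition push_coeff :: "nat \<Rightarrow> complex \<Rightarrow> complex \<Rightarrow> int \<Rightarrow> nat \<Rightarrow> nat \<Rightarrow> complex" where
  "push_coeff s h q e n r = h ^ (n - r) * q powi (int r * e) * gauss_binomial (q ^ s) n r
     * (\<Prod>i<n - r. q_bracket q (e + int s * int i))"

lemma push_coeff_eq_0: "n < r \<Longrightarrow> push_coeff s h q e n r = 0"
  by (simp add: push_coeff_def gauss_binomial_eq_0)

lemma push_coeff_Suc_0:
  "push_coeff s h q e (Suc n) 0 = h * q_bracket q (e + int s * int n) * push_coeff s h q e n 0"
  by (simp add: push_coeff_def)

text \<open>Both summands share the factor \<open>h^(n-r) q^((r+1)e) P\<close>; what remains is the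
  Pascal rule in base \<open>q^s\<close>, whose weight is the surplus
  \<open>q^(s(n-r))\<close>.\<close>

lemma push_coeff_Suc_Suc:
  assumes q: "q \<noteq> 0" and r: "r \<le> n"
  shows "push_coeff s h q e (Suc n) (Suc r)
    = q powi (e + int s * int (n - r)) * push_coeff s h q e n r
      + h * q_bracket q (e + int s * int (n - Suc r)) * push_coeff s h q e n (Suc r)"
proof -
  define P where "P = (\<Prod>i<n - r. q_bracket q (e + int s * int i))"
  have pw: "q powi (e + int s * int (n - r)) * q powi (int r * e)
      = q powi (int (Suc r) * e) * (q ^ s) ^ (n - r)"
  proof -
    have "(q ^ s) ^ (n - r) = q powi (int s * int (n - r))"
      by (simp add: power_mult flip: of_nat_mult)
    then show ?thesis
      using q by (simp add: power_int_add[symmetric] algebra_simps)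
  qed
  have "q powi (e + int s * int (n - r)) * push_coeff s h q e n r
      = (q powi (e + int s * int (n - r)) * q powi (int r * e))
        * (h ^ (n - r) * gauss_binomial (q ^ s) n r * P)"
    unfolding push_coeff_def P_def by (simp only: mult_ac)
  then have 1: "q powi (e + int s * int (n - r)) * push_coeff s h q e n r
      = h ^ (n - r) * q powi (int (Suc r) * e) * ((q ^ s) ^ (n - r) * gauss_binomial (q ^ s) n r) * P"
    unfolding pw by (simp only: mult_ac)
  have 2: "h * q_bracket q (e + int s * int (n - Suc r)) * push_coeff s h q e n (Suc r)
      = h ^ (n - r) * q powi (int (Suc r) * e) * gauss_binomial (q ^ s) n (Suc r) * P"
  proof (cases "r = n")
    case True
    \<comment> \<open>The truncated \<open>n - Suc r\<close> is harmless here: the coefficients with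
      index \<open>n + 1\<close> vanish.\<close>
    then show ?thesis by (simp add: push_coeff_eq_0 gauss_binomial_eq_0)
  next
    case False
    with r have "n - r = Suc (n - Suc r)" by simp
    then show ?thesis by (simp add: push_coeff_def P_def mult_ac)
  qed
  show ?thesis
    unfolding 1 2 using r
    by (simp add: push_coeff_def P_def gauss_binomial_pascal algebra_simps)
qed

text \<open>One more factor \<open>V U\<close> on the left, with \<open>X r\<close> in the role of
  \<open>(V U)^r\<close>; \<open>X\<close> is arbitrary so that coefficient sequences can be
  inserted.\<close>

lemma sum_push_coeff_Suc:
  assumes "q \<noteq> 0"
  shows "(\<Sum>r\<le>n. push_coeff s h q e n r *
            (q powi (e + int s * int (n - r)) * X (Suc r)
             + h * q_bracket q (e + int s * int (n - r)) * X r))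
       = (\<Sum>r\<le>Suc n. push_coeff s h q e (Suc n) r * X r)"
proof -
  define c where "c = push_coeff s h q e n"
  define f where "f r = q powi (e + int s * int (n - r)) * c r * X (Suc r)" for r
  define g where "g r = h * q_bracket q (e + int s * int (n - r)) * c r * X r" for r
  have "g (Suc n) = 0"
    by (simp add: g_def c_def push_coeff_eq_0)
  then have shift: "(\<Sum>r\<le>n. g r) = g 0 + (\<Sum>r\<le>n. g (Suc r))"
    using sum.atMost_Suc[of g n] sum.atMost_Suc_shift[of g n] by simp
  have "(\<Sum>r\<le>n. c r * (q powi (e + int s * int (n - r)) * X (Suc r)
             + h * q_bracket q (e + int s * int (n - r)) * X r)) = (\<Sum>r\<le>n. f r + g r)"
    by (simp add: f_def g_def algebra_simps)
  also have "\<dots> = g 0 + (\<Sum>r\<le>n. f r + g (Suc r))"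
    by (simp add: sum.distrib shift)
  also have "(\<Sum>r\<le>n. f r + g (Suc r)) = (\<Sum>r\<le>n. push_coeff s h q e (Suc n) (Suc r) * X (Suc r))"
    using assms by (intro sum.cong) (auto simp: push_coeff_Suc_Suc f_def g_def c_def distrib_right)
  also have "g 0 = push_coeff s h q e (Suc n) 0 * X 0"
    by (simp add: g_def c_def push_coeff_Suc_0)
  finally show ?thesis
    unfolding c_def sum.atMost_Suc_shift[of _ n] .
qed

text \<open>
  Left multiplication by \<open>V U\<close> of \<open>\<Sum>\<^sub>k f(k) V\<^bsup>sN-(s-1)k\<^esup> U\<^sup>k\<close>.
\<close>

definition bell_step :: "nat \<Rightarrow> complex \<Rightarrow> complex \<Rightarrow> nat \<Rightarrow> (nat \<Rightarrow> complex) \<Rightarrow> nat \<Rightarrow> complex" where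
  "bell_step s h q N f k =
     (if k = 0 then 0 else q powi (int s * int N - (int s - 1) * int (k - 1)) * f (k - 1))
     + h * q_bracket q (int s * int N - (int s - 1) * int k) * f k"

lemma bell_step_sum:
  "bell_step s h q N (\<lambda>k. \<Sum>i\<in>A. a i * f i k) k = (\<Sum>i\<in>A. a i * bell_step s h q N (f i) k)"
  by (simp add: bell_step_def sum_distrib_left sum_distrib_right sum.distrib distrib_left mult_ac)

text \<open>Mirrors \<open>(V U)^(n+1) = (V U) (V U)^n\<close>. At \<open>k = 0\<close> the right
  side vanishes: \<open>S[n,0] = 0\<close> for \<open>n > 0\<close>, and the bracket is 0 for
  \<open>n = 0\<close>.\<close>

lemma gen_stirling_Suc: "gen_stirling s h q (Suc n) k = bell_step s h q n (gen_stirling s h q n) k"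
  by (cases k; cases n) (simp_all add: bell_step_def)

text \<open>Right multiplication by \<open>U^j\<close> on coefficients, or by \<open>x^j\<close> on
  polynomials.\<close>

definition shift_seq :: "nat \<Rightarrow> (nat \<Rightarrow> complex) \<Rightarrow> nat \<Rightarrow> complex" where
  "shift_seq j f k = (if k < j then 0 else f (k - j))"

text \<open>Coefficient form of \<open>(V U) V^E (V U)^r U^j = q^E V^E (V U)^(r+1) U^j + h [E]
  V^(E+s) (V U)^r U^j\<close>. It rests on \<open>[E+w] = [E] + q^E [w]\<close>.\<close>

lemma bell_step_shift:
  fixes s j m n r :: nat
  assumes q: "q \<noteq> 0" and r: "r \<le> n"
  defines "E \<equiv> int j * (1 - int s) + int s * int m + int s * int (n - r)"
  shows "bell_step s h q (n + m) (shift_seq j (gen_stirling s h q r)) k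
    = q powi E * shift_seq j (gen_stirling s h q (Suc r)) k
      + h * q_bracket q E * shift_seq j (gen_stirling s h q r) k"
proof (cases "k < j")
  case True
  then show ?thesis by (simp add: bell_step_def shift_seq_def)
next
  case False
  then obtain l where k: "k = j + l" using le_Suc_ex not_less by blast
  \<comment> \<open>The \<open>V\<close>-exponent at \<open>U^(j+l)\<close> is \<open>E\<close> plus
    the exponent at \<open>U^l\<close> in \<open>(V U)^r\<close>.\<close>
  have w: "int s * int (n + m) - (int s - 1) * int (j + l)
      = E + (int s * int r - (int s - 1) * int l)" for l
    using r by (simp add: E_def of_nat_diff algebra_simps)
  have b: "q_bracket q (int s * int (n + m) - (int s - 1) * int (j + l))
      = q_bracket q E + q powi E * q_bracket q (int s * int r - (int s - 1) * int l)" for l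
    unfolding w by (rule q_bracket_add[OF q])
  have p: "q powi (int s * int (n + m) - (int s - 1) * int (j + l))
      = q powi E * q powi (int s * int r - (int s - 1) * int l)" for l
    unfolding w using q by (simp add: power_int_add)
  show ?thesis
  proof (cases l)
    case 0
    then have "bell_step s h q (n + m) (shift_seq j (gen_stirling s h q r)) k
      = h * q_bracket q (int s * int (n + m) - (int s - 1) * int (j + l)) * gen_stirling s h q r l"
      by (simp add: k bell_step_def shift_seq_def)
    then show ?thesis
      unfolding b gen_stirling_Suc using 0 by (simp add: k bell_step_def shift_seq_def algebra_simps)
  next
    case (Suc l')
    then have "bell_step s h q (n + m) (shift_seq j (gen_stirling s h q r)) k
      = q powi (int s * int (n + m) - (int s - 1) * int (j + l')) * gen_stirling s h q r l'
        + h * q_bracket q (int s * int (n + m) - (int s - 1) * int (j + l)) * gen_stirling s h q r l"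
      by (simp add: k bell_step_def shift_seq_def)
    also have "\<dots> = q powi E * bell_step s h q r (gen_stirling s h q r) l
        + h * q_bracket q E * gen_stirling s h q r l"
      unfolding b p using Suc by (simp add: bell_step_def algebra_simps)
    finally show ?thesis
      by (simp add: k shift_seq_def gen_stirling_Suc)
  qed
qed

text \<open>Expands \<open>(V U)^n (V U)^m\<close> by normal ordering the right factor. Induction on
  \<open>n\<close> acts on coefficient sequences alone, so no algebra containing \<open>U\<close>
  and \<open>V\<close> has to be constructed.\<close>

lemma gen_stirling_add:
  assumes q: "q \<noteq> 0"
  shows "gen_stirling s h q (n + m) k =
    (\<Sum>j\<le>m. gen_stirling s h q m j *
      (\<Sum>r\<le>n. push_coeff s h q (int j * (1 - int s) + int s * int m) n r
                * shift_seq j (gen_stirling s h q r) k))"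
proof (induction n arbitrary: k)
  case 0
  have "gen_stirling s h q m j * shift_seq j (gen_stirling s h q 0) k
      = (if j = k then gen_stirling s h q m j else 0)" for j
    by (cases "k - j") (auto simp: shift_seq_def)
  then show ?case
    by (simp add: push_coeff_def gen_stirling_0)
next
  case (Suc n)
  define e where "e j = int j * (1 - int s) + int s * int m" for j
  have "gen_stirling s h q (Suc n + m) k
      = bell_step s h q (n + m) (\<lambda>k. gen_stirling s h q (n + m) k) k"
    by (simp add: gen_stirling_Suc)
  also have "\<dots> = (\<Sum>j\<le>m. gen_stirling s h q m j * (\<Sum>r\<le>n. push_coeff s h q (e j) n r
      * bell_step s h q (n + m) (shift_seq j (gen_stirling s h q r)) k))"
    unfolding Suc.IH bell_step_sum e_def[symmetric] ..
  also have "\<dots> = (\<Sum>j\<le>m. gen_stirling s h q m j * (\<Sum>r\<le>n. push_coeff s h q (e j) n r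
      * (q powi (e j + int s * int (n - r)) * shift_seq j (gen_stirling s h q (Suc r)) k
         + h * q_bracket q (e j + int s * int (n - r)) * shift_seq j (gen_stirling s h q r) k)))"
    unfolding e_def by (intro sum.cong refl arg_cong2[of _ _ _ _ "(*)"] bell_step_shift[OF q]) auto
  also have "\<dots> = (\<Sum>j\<le>m. gen_stirling s h q m j * (\<Sum>r\<le>Suc n. push_coeff s h q (e j) (Suc n) r
      * shift_seq j (gen_stirling s h q r) k))"
    by (simp only: sum_push_coeff_Suc[OF q, where X = "\<lambda>r. shift_seq _ (gen_stirling s h q r) k"])
  finally show ?case unfolding e_def .
qed

section \<open>Passage to Bell polynomials and specializations\<close>

lemma coeff_gen_bell: "coeff (gen_bell s h q n) k = gen_stirling s h q n k"
  by (simp add: gen_bell_def coeff_sum gen_stirling_0)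

lemma gen_bell_add:
  assumes "q \<noteq> 0"
  shows "gen_bell s h q (n + m) =
    (\<Sum>r=0..n. \<Sum>j=0..m.
      smult (push_coeff s h q (int j * (1 - int s) + int s * int m) n r * gen_stirling s h q m j)
        (gen_bell s h q r * monom 1 j))"
proof (rule poly_eqI)
  fix k
  have "coeff (gen_bell s h q r * monom 1 j) k = shift_seq j (gen_stirling s h q r) k" for r j
    by (simp add: mult.commute[of _ "monom 1 j"] coeff_monom_mult shift_seq_def coeff_gen_bell)
  then show "coeff (gen_bell s h q (n + m)) k = coeff (\<Sum>r=0..n. \<Sum>j=0..m.
      smult (push_coeff s h q (int j * (1 - int s) + int s * int m) n r * gen_stirling s h q m j)
        (gen_bell s h q r * monom 1 j)) k"
    unfolding coeff_gen_bell gen_stirling_add[OF assms]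
    by (subst sum.swap) (simp add: coeff_sum atMost_atLeast0 sum_distrib_left mult_ac)
qed

theorem corollary19:
  fixes s :: nat and h q :: complex
  assumes "h \<noteq> 0" and "q \<noteq> 0"
  shows
    "(\<forall>n m :: nat.
        gen_bell s h q (n + m) =
          (\<Sum>r=0..n. \<Sum>j=0..m.
             smult (h ^ (n - r)
                    * q powi (int r * (int j * (1 - int s) + int s * int m))
                    * gauss_binomial (q ^ s) n r
                    * gen_stirling s h q m j
                    * (\<Prod>i<n - r. q_bracket q (int j * (1 - int s) + int s * int m + int s * int i)))
               (gen_bell s h q r * monom 1 j)))
     \<and> (\<forall>n :: nat. n \<ge> 1 \<longrightarrow>
        gen_bell s h q n =
          (\<Sum>r=0..n - 1.
             smult (h ^ (n - r - 1)
                    * q ^ r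
                    * gauss_binomial (q ^ s) (n - 1) r
                    * (\<Prod>i<n - r - 1. q_bracket q (1 + int s * int i)))
               (gen_bell s h q r * monom 1 1)))
     \<and> (\<forall>n m :: nat.
        q_bell q (n + m) =
          (\<Sum>r=0..n. \<Sum>j=0..m.
             q ^ (r * j) * of_nat (n choose r) * q_stirling q m j * q_bell q r
             * q_bracket q (int j) ^ (n - r)))"
proof (intro conjI allI impI)
  show add: "gen_bell s h q (n + m) =
          (\<Sum>r=0..n. \<Sum>j=0..m.
             smult (h ^ (n - r)
                    * q powi (int r * (int j * (1 - int s) + int s * int m))
                    * gauss_binomial (q ^ s) n r
                    * gen_stirling s h q m j
                    * (\<Prod>i<n - r. q_bracket q (int j * (1 - int s) + int s * int m + int s * int i)))
               (gen_bell s h q r * monom 1 j))" for n m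
    unfolding gen_bell_add[OF assms(2)] push_coeff_def by (simp only: mult_ac)
  fix n :: nat
  assume "n \<ge> 1"
  then have "gen_bell s h q n = gen_bell s h q (n - 1 + 1)" by simp
  also have "\<dots> = (\<Sum>r=0..n - 1.
             smult (h ^ (n - r - 1)
                    * q ^ r
                    * gauss_binomial (q ^ s) (n - 1) r
                    * (\<Prod>i<n - r - 1. q_bracket q (1 + int s * int i)))
               (gen_bell s h q r * monom 1 1))"
    \<comment> \<open>With \<open>m = 1\<close> only \<open>j = 1\<close> survives, since
      \<open>S[1,0] = 0\<close> and \<open>S[1,1] = 1\<close>; then
      \<open>j(1-s)+sm = 1\<close>.\<close>
    unfolding add by (simp add: diff_right_commute)
  finally show "gen_bell s h q n = \<dots>" .
next
  fix n m :: nat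
  have "q_bell q (n + m) = (\<Sum>r=0..n. \<Sum>j=0..m.
      push_coeff 0 1 q (int j) n r * gen_stirling 0 1 q m j * q_bell q r)"
    unfolding q_bell_def gen_bell_add[OF assms(2)] by (simp add: poly_sum poly_monom)
  \<comment> \<open>For \<open>s = 0\<close> all \<open>n - r\<close> factors of the product equal
    \<open>[j]\<close>, and the Gaussian coefficient in base 1 is the ordinary binomial.\<close>
  also have "\<dots> = (\<Sum>r=0..n. \<Sum>j=0..m.
      q ^ (r * j) * of_nat (n choose r) * q_stirling q m j * q_bell q r * q_bracket q (int j) ^ (n - r))"
    by (simp add: push_coeff_def q_stirling_def gauss_binomial_1 power_int_of_nat mult_ac
        flip: of_nat_mult)
  finally show "q_bell q (n + m) = \<dots>" .
qed

end
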